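(* Let $n=16p_1p_2\cdots p_i$, where $i\ge0$ and $p_1,\dots,p_i$ are mutually distinct odd primes. Then the number of proper skew morphisms of $\mathbb{Z}_n$ of order $4$ is $2^{i+2}$. In particular, $4$ is not skew bounded.
   Context: $\mathbb{Z}_n$ is the cyclic group of integers modulo $n$. A skew morphism of a finite group $G$ is a permutation $\varphi$ of $G$ fixing the identity such that for each $a\in G$ there is a non-negative integer $i_a$ with $\varphi(ab)=\varphi(a)\varphi^{i_a}(b)$ for all $b\in G$. A skew morphism that is not a group automorphism is called proper. The order of $\varphi$ is the order of $\langle\varphi\rangle$. A positive integer $\ell$ is called skew bounded if there is a constant $C$ such that for every positive integer $n$ the number of proper skew morphisms of $\mathbb{Z}_n$ of order $\ell$ is at most $C$. *)

theory Defs
  imports "HOL-Computational_Algebra.Primes"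
begin

text \<open>The cyclic group Z_n is modelled by the carrier {..<n} with addition mod n.
  A map on Z_n is a function nat => nat that is the identity outside {..<n}
  (so that distinct maps on Z_n correspond to distinct HOL functions).\<close>

definition skew_morphism :: "nat \<Rightarrow> (nat \<Rightarrow> nat) \<Rightarrow> bool" where
  "skew_morphism n \<phi> \<longleftrightarrow>
     (\<forall>x. n \<le> x \<longrightarrow> \<phi> x = x) \<and>
     bij_betw \<phi> {..<n} {..<n} \<and>
     \<phi> 0 = 0 \<and>
     (\<forall>a<n. \<exists>i::nat. \<forall>b<n. \<phi> ((a + b) mod n) = (\<phi> a + (\<phi> ^^ i) b) mod n)"

definition is_automorphism_map :: "nat \<Rightarrow> (nat \<Rightarrow> nat) \<Rightarrow> bool" where
  "is_automorphism_map n \<phi> \<longleftrightarrow>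
     (\<forall>a<n. \<forall>b<n. \<phi> ((a + b) mod n) = (\<phi> a + \<phi> b) mod n)"

definition proper_skew_morphism :: "nat \<Rightarrow> (nat \<Rightarrow> nat) \<Rightarrow> bool" where
  "proper_skew_morphism n \<phi> \<longleftrightarrow> skew_morphism n \<phi> \<and> \<not> is_automorphism_map n \<phi>"

definition skew_order :: "nat \<Rightarrow> (nat \<Rightarrow> nat) \<Rightarrow> nat" where
  "skew_order n \<phi> = (LEAST k. 0 < k \<and> (\<forall>x<n. (\<phi> ^^ k) x = x))"

definition proper_skew_of_order :: "nat \<Rightarrow> nat \<Rightarrow> (nat \<Rightarrow> nat) set" where
  "proper_skew_of_order n l = {\<phi>. proper_skew_morphism n \<phi> \<and> skew_order n \<phi> = l}"

definition skew_bounded :: "nat \<Rightarrow> bool" where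
  "skew_bounded l \<longleftrightarrow> (\<exists>C::nat. \<forall>n>0. card (proper_skew_of_order n l) \<le> C)"

end

theory Submission
  imports Defs "HOL-Number_Theory.Cong" "HOL-Combinatorics.Cycles"
begin

text \<open>Let \<open>\<phi>\<close> be a proper skew morphism of order 4. Comparing \<open>\<phi>\<^sup>k\<close> on sums shows that the
  exponents sum to \<open>0\<close> modulo 4 over four steps of \<open>\<phi>\<close> and not over fewer. This forces all exponents
  to be \<open>1\<close> or \<open>3\<close> and constant on orbits, so they are multiplicative modulo 4 and, by properness,
  equal to \<open>3\<close> exactly on the odd residues. With \<open>n = 2m\<close>, \<open>\<phi>\<close> is then determined by
  \<open>\<phi> 2 = 2s\<close> and \<open>\<phi> 1 = 1 + 2h\<close>, and the admissible pairs \<open>(s, h)\<close> modulo \<open>m\<close> are the solutions of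
  a polynomial system. By the Chinese remainder theorem they can be counted
  prime by prime: four solutions modulo 8, and \<open>(1, 0)\<close>, \<open>(-1, -1)\<close> modulo each odd prime.\<close>

section \<open>Maps of Z_2m that are affine on each parity class\<close>

text \<open>Left unreduced, so that iterates stay polynomial in \<open>s\<close> and
  \<open>h\<close> and reduction modulo n is deferred to congruences between halves.\<close>

definition twist :: "nat \<Rightarrow> nat \<Rightarrow> nat \<Rightarrow> nat" where
  "twist s h x = 2 * (s * (x div 2) + (x mod 2) * h) + x mod 2"

definition twist_perm :: "nat \<Rightarrow> nat \<Rightarrow> nat \<Rightarrow> nat \<Rightarrow> nat" where
  "twist_perm n s h x = (if x < n then twist s h x mod n else x)"

text \<open>For the induced map \<open>\<phi>\<close> on Z_2m the three congruences express, in
  order, \<open>(\<phi> ^^ 2) 2 = 2\<close>,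
  \<open>\<phi> (1 + 1) = \<phi> 1 + (\<phi> ^^ 3) 1\<close> and \<open>(\<phi> ^^ 4) 1 = 1\<close>,
  each after halving.\<close>

definition twist_sys :: "nat \<Rightarrow> nat \<Rightarrow> nat \<Rightarrow> bool" where
  "twist_sys m s h \<longleftrightarrow> [s * s = 1] (mod m) \<and> [s = 1 + 3 * h + s * h] (mod m) \<and>
     [2 * (h + s * h) = 0] (mod m)"

text \<open>The square of the map moves 1 by \<open>2 * (h + s * h)\<close>, so the last condition
  says that the order does not drop to a divisor of 2.\<close>

definition twist_params :: "nat \<Rightarrow> (nat \<times> nat) set" where
  "twist_params m = {(s, h). s < m \<and> h < m \<and> twist_sys m s h \<and> \<not> m dvd h + s * h}"

lemma twist_even [simp]: "twist s h (2 * y) = 2 * (s * y)"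
  by (simp add: twist_def)

lemma twist_odd [simp]: "twist s h (Suc (2 * y)) = Suc (2 * (s * y + h))"
  by (simp add: twist_def)

lemma cong_double_iff: "[2 * a = 2 * b] (mod (2 * m)) \<longleftrightarrow> [a = b] (mod m)" for a b m :: nat
  by (simp add: cong_def mod_mult_mult1)

lemma cong_Suc_double_iff:
  "[Suc (2 * a) = Suc (2 * b)] (mod (2 * m)) \<longleftrightarrow> [a = b] (mod m)" for a b m :: nat
  using cong_add_rcancel_nat[of "2 * a" 1 "2 * b" "2 * m"] by (simp add: cong_double_iff)

text \<open>As the modulus is even, a residue determines its parity and its half modulo
  \<open>m\<close>, so the formula descends to Z_2m.\<close>

lemma twist_cong:
  assumes "[x = y] (mod (2 * m))"
  shows "[twist s h x = twist s h y] (mod (2 * m))"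
proof -
  have par: "x mod 2 = y mod 2"
    using assms by (metis cong_def dvd_triv_left mod_mod_cancel)
  have "[x div 2 = y div 2] (mod m)"
  proof -
    have "[2 * (x div 2) + x mod 2 = 2 * (y div 2) + x mod 2] (mod (2 * m))"
      using assms par by (metis mult_div_mod_eq)
    then show ?thesis
      by (simp only: cong_add_rcancel_nat cong_double_iff)
  qed
  then have "[s * (x div 2) + (x mod 2) * h = s * (y div 2) + (y mod 2) * h] (mod m)"
    unfolding par by (intro cong_add cong_mult cong_refl)
  then show ?thesis
    unfolding twist_def par by (intro cong_add cong_refl) (simp only: cong_double_iff)
qed

lemma funpow_eq_twist:
  assumes "0 < m" "\<And>x. x < 2 * m \<Longrightarrow> \<phi> x = twist s h x mod (2 * m)" "x < 2 * m"
  shows "(\<phi> ^^ k) x = (twist s h ^^ k) x mod (2 * m)"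
proof (induction k)
  case 0
  then show ?case using assms by simp
next
  case (Suc k)
  have "\<phi> ((\<phi> ^^ k) x) = twist s h ((twist s h ^^ k) x mod (2 * m)) mod (2 * m)"
    using assms Suc by simp
  also have "\<dots> = twist s h ((twist s h ^^ k) x) mod (2 * m)"
    using twist_cong[of "(twist s h ^^ k) x mod (2 * m)" "(twist s h ^^ k) x" m]
    by (simp add: cong_def)
  finally show ?case by simp
qed

section \<open>Iterates, small sums and exponent patterns on a 4-cycle\<close>

lemma nat_cases_parity:
  fixes x :: nat
  obtains (even) y where "x = 2 * y" | (odd) y where "x = Suc (2 * y)"
  by (metis oddE evenE add.commute plus_1_eq_Suc)

lemma funpow_mod:
  assumes "(f ^^ k) x = x"
  shows "(f ^^ i) x = (f ^^ (i mod k)) x"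
proof -
  have "(f ^^ (k * j)) x = x" for j
    by (induction j) (simp_all add: funpow_add assms)
  then show ?thesis
    by (metis comp_apply funpow_add mod_mult_div_eq)
qed

lemma funpow_small:
  shows "(f ^^ 2) x = f (f x)" "(f ^^ 3) x = f (f (f x))" "(f ^^ 4) x = f (f (f (f x)))"
  by (simp_all add: eval_nat_numeral)

lemma sum_lessThan_small:
  fixes f :: "nat \<Rightarrow> nat"
  shows "(\<Sum>i<2. f i) = f 0 + f 1" "(\<Sum>i<4. f i) = f 0 + f 1 + f 2 + f 3"
  by (simp_all add: eval_nat_numeral)

lemma add_mod_left_cancel:
  "(c + x) mod n = (c + y) mod n \<Longrightarrow> x < n \<Longrightarrow> y < n \<Longrightarrow> x = y" for c x y n :: nat
  using cong_add_lcancel_nat[of c x y n] by (simp add: cong_def)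

text \<open>The condition on neighbours forbids 13 and 22, and the total then leaves 1111, 3333 and
  the four rotations of 2123. Each of the last four hypotheses excludes one rotation.\<close>

lemma orbit_pattern:
  fixes w x y z :: nat
  assumes "w = 1 \<or> w = 2 \<or> w = 3" "x = 1 \<or> x = 2 \<or> x = 3"
    "y = 1 \<or> y = 2 \<or> y = 3" "z = 1 \<or> z = 2 \<or> z = 3"
    and "(w + x) mod 4 \<noteq> 0" "(x + y) mod 4 \<noteq> 0" "(y + z) mod 4 \<noteq> 0" "(z + w) mod 4 \<noteq> 0"
    and "(w + x + y + z) mod 4 = 0"
    and "\<not> (w = 2 \<and> x = 1 \<and> y \<noteq> 1)" "\<not> (w = 2 \<and> z = 1 \<and> w \<noteq> 1)"
    and "\<not> (x = 2 \<and> w = 1 \<and> x \<noteq> 1)" "\<not> (x = 2 \<and> y = 1 \<and> z \<noteq> 1)"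
  shows "w \<in> {1, 3} \<and> x = w"
  using assms(1-4) by (elim disjE) (use assms(5-) in simp_all)

section \<open>Exponents of a skew morphism of order 4\<close>

text \<open>\<open>pow4\<close> and \<open>pow2\<close> together encode exact order 4. Automorphisms
  are still allowed; properness enters with \<open>e_parity\<close>.\<close>

locale order4_skew =
  fixes n :: nat and \<phi> :: "nat \<Rightarrow> nat"
  assumes n: "0 < n"
    and lt: "x < n \<Longrightarrow> \<phi> x < n"
    and zero: "\<phi> 0 = 0"
    and skew: "a < n \<Longrightarrow> \<exists>i. \<forall>b<n. \<phi> ((a + b) mod n) = (\<phi> a + (\<phi> ^^ i) b) mod n"
    and pow4: "x < n \<Longrightarrow> (\<phi> ^^ 4) x = x"
    and pow2: "\<exists>w<n. (\<phi> ^^ 2) w \<noteq> w"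
begin

lemma pow_lt: "x < n \<Longrightarrow> (\<phi> ^^ k) x < n"
  by (induction k) (auto simp: lt)

lemma pow_zero: "(\<phi> ^^ k) 0 = 0"
  by (induction k) (auto simp: zero)

lemma pow_mod4: "x < n \<Longrightarrow> (\<phi> ^^ (k mod 4)) x = (\<phi> ^^ k) x"
  by (rule funpow_mod[OF pow4, symmetric])

text \<open>Unless 4 divides \<open>k\<close>, one of \<open>k\<close> and \<open>2k\<close> is 2
  modulo 4, and then the square would be the identity, against \<open>pow2\<close>.\<close>

lemma pow_id_imp:
  assumes "\<And>x. x < n \<Longrightarrow> (\<phi> ^^ k) x = x"
  shows "k mod 4 = 0"
proof -
  have "(\<phi> ^^ (k + k)) x = x" if "x < n" for x
    using that by (simp add: funpow_add assms pow_lt)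
  moreover have "(\<phi> ^^ (k + k + k)) x = x" if "x < n" for x
    using that by (simp add: funpow_add assms pow_lt)
  ultimately have *: "(\<phi> ^^ (j mod 4)) x = x" if "x < n" "j \<in> {k, k + k, k + k + k}" for x j
    using that assms by (auto simp: pow_mod4)
  obtain w where w: "w < n" "(\<phi> ^^ 2) w \<noteq> w" using pow2 by blast
  have "k mod 4 \<noteq> 2" using *[of w k] w by auto
  moreover have "(k + k) mod 4 \<noteq> 2" using *[of w "k + k"] w by auto
  ultimately show ?thesis by presburger
qed

lemma pow_eq_imp:
  assumes "\<And>x. x < n \<Longrightarrow> (\<phi> ^^ i) x = (\<phi> ^^ j) x"
  shows "i mod 4 = j mod 4"
proof -
  \<comment> \<open>The exponent \<open>3 * j\<close> plays the role of \<open>-j\<close>, because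
    the power \<open>4 * j\<close> is the identity.\<close>
  have "(\<phi> ^^ (i + 3 * j)) x = x" if x: "x < n" for x
  proof -
    have "(\<phi> ^^ (i + 3 * j)) x = (\<phi> ^^ i) ((\<phi> ^^ (3 * j)) x)"
      by (simp add: funpow_add)
    also have "\<dots> = (\<phi> ^^ j) ((\<phi> ^^ (3 * j)) x)"
      using assms pow_lt x by simp
    also have "\<dots> = (\<phi> ^^ (4 * j)) x"
      by (simp flip: funpow_add comp_apply[of "\<phi> ^^ j"])
    also have "\<dots> = x"
      using pow_mod4[of x "4 * j"] x by simp
    finally show ?thesis .
  qed
  then have "(i + 3 * j) mod 4 = 0" by (rule pow_id_imp)
  then show ?thesis by presburger
qed

text \<open>The power function of \<open>\<phi>\<close>, normalised below 4; this makes the choice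
  unique, see \<open>e_unique\<close>.\<close>

definition e :: "nat \<Rightarrow> nat" where
  "e a = (SOME i. i < 4 \<and> (\<forall>b<n. \<phi> ((a + b) mod n) = (\<phi> a + (\<phi> ^^ i) b) mod n))"

lemma e: assumes "a < n"
  shows e_less: "e a < 4"
    and e_add: "b < n \<Longrightarrow> \<phi> ((a + b) mod n) = (\<phi> a + (\<phi> ^^ e a) b) mod n"
proof -
  obtain i where i: "\<forall>b<n. \<phi> ((a + b) mod n) = (\<phi> a + (\<phi> ^^ i) b) mod n"
    using skew[OF assms] by blast
  have "i mod 4 < 4 \<and> (\<forall>b<n. \<phi> ((a + b) mod n) = (\<phi> a + (\<phi> ^^ (i mod 4)) b) mod n)"
    using i by (simp add: pow_mod4)
  then have "e a < 4 \<and> (\<forall>b<n. \<phi> ((a + b) mod n) = (\<phi> a + (\<phi> ^^ e a) b) mod n)"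
    unfolding e_def by (rule someI)
  then show "e a < 4" and "b < n \<Longrightarrow> \<phi> ((a + b) mod n) = (\<phi> a + (\<phi> ^^ e a) b) mod n"
    by blast+
qed

lemma e_unique:
  assumes "a < n" "\<And>b. b < n \<Longrightarrow> \<phi> ((a + b) mod n) = (\<phi> a + (\<phi> ^^ i) b) mod n"
  shows "e a = i mod 4"
proof -
  have "e a mod 4 = i mod 4"
  proof (rule pow_eq_imp)
    fix x assume x: "x < n"
    then have "(\<phi> a + (\<phi> ^^ e a) x) mod n = (\<phi> a + (\<phi> ^^ i) x) mod n"
      using assms e_add by metis
    then show "(\<phi> ^^ e a) x = (\<phi> ^^ i) x"
      using add_mod_left_cancel pow_lt x by blast
  qed
  then show ?thesis using e_less[OF assms(1)] by simp
qed

text \<open>Applying the skew law at \<open>(\<phi> ^^ k) a\<close> adds the exponent of that orbit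
  point to the exponent accumulated on \<open>b\<close>.\<close>

lemma pow_add:
  assumes "a < n" "b < n"
  shows "(\<phi> ^^ k) ((a + b) mod n) = ((\<phi> ^^ k) a + (\<phi> ^^ (\<Sum>i<k. e ((\<phi> ^^ i) a))) b) mod n"
proof (induction k)
  case 0
  then show ?case by simp
next
  case (Suc k)
  then show ?case
    using e_add[of "(\<phi> ^^ k) a" "(\<phi> ^^ (\<Sum>i<k. e ((\<phi> ^^ i) a))) b"] assms pow_lt
    by (simp add: funpow_add add.commute)
qed

text \<open>With a vanishing exponent sum, \<open>\<phi> ^^ k\<close> is a translation; since it
  fixes 0 it is the identity, and 4 divides \<open>k\<close>.\<close>

lemma orbit_sum_eq_0_imp:
  assumes "a < n" "(\<Sum>i<k. e ((\<phi> ^^ i) a)) mod 4 = 0"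
  shows "k mod 4 = 0"
proof -
  \<comment> \<open>The translation amount \<open>(\<phi> ^^ k) a - a\<close>, with
    \<open>n - a\<close> standing for \<open>-a\<close>.\<close>
  define c where "c = (\<phi> ^^ k) a + (n - a)"
  have tr: "(\<phi> ^^ k) x = (c + x) mod n" if x: "x < n" for x
  proof -
    define b where "b = (x + (n - a)) mod n"
    have b: "b < n" "(a + b) mod n = x"
      using x assms n by (auto simp: b_def mod_simps)
    have "(\<phi> ^^ k) x = ((\<phi> ^^ k) a + b) mod n"
      using pow_add[OF assms(1) b(1), of k] b pow_mod4[OF b(1)] assms(2) by (metis funpow_0)
    then show ?thesis by (simp add: b_def c_def mod_simps ac_simps)
  qed
  have "c mod n = 0" using tr[of 0] n by (simp add: pow_zero)
  then have "(\<phi> ^^ k) x = x" if "x < n" for x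
    using tr[OF that] that by (metis add_0 mod_add_left_eq mod_less)
  then show ?thesis by (rule pow_id_imp)
qed

lemma orbit_sum4:
  assumes "a < n"
  shows "(\<Sum>i<4. e ((\<phi> ^^ i) a)) mod 4 = 0"
proof (rule pow_id_imp)
  fix x assume x: "x < n"
  have "(a + x) mod n = (a + (\<phi> ^^ (\<Sum>i<4. e ((\<phi> ^^ i) a))) x) mod n"
    using pow_add[OF assms x, of 4] pow4[OF assms] pow4[of "(a + x) mod n"] n by simp
  then show "(\<phi> ^^ (\<Sum>i<4. e ((\<phi> ^^ i) a))) x = x"
    using add_mod_left_cancel pow_lt x by metis
qed

lemma e_neq_0: "a < n \<Longrightarrow> e a \<noteq> 0"
  using orbit_sum_eq_0_imp[of a 1] by fastforce

lemma e_adjacent: "a < n \<Longrightarrow> (e a + e (\<phi> a)) mod 4 \<noteq> 0"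
  using orbit_sum_eq_0_imp[of a 2, unfolded sum_lessThan_small] by fastforce

lemma e_cycle: "a < n \<Longrightarrow> (e a + e (\<phi> a) + e (\<phi> (\<phi> a)) + e (\<phi> (\<phi> (\<phi> a)))) mod 4 = 0"
  using orbit_sum4[of a] by (simp add: sum_lessThan_small funpow_small)

lemma phi4: "a < n \<Longrightarrow> \<phi> (\<phi> (\<phi> (\<phi> a))) = a"
  using pow4[of a] by (simp only: funpow_small)

text \<open>Expanding \<open>\<phi> (a + k)\<close> from either summand gives
  \<open>\<phi> (\<phi> k) = \<phi> k\<close>, and \<open>\<phi>\<close> is injective because its
  fourth power is the identity.\<close>

lemma kernel_fixed:
  assumes "a < n" "k < n" "e a = 2" "e k = 1"
  shows "\<phi> k = k"
proof -
  have "(\<phi> a + \<phi> (\<phi> k)) mod n = (\<phi> a + \<phi> k) mod n"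
    using e_add[of a k] e_add[of k a] assms by (simp add: add.commute funpow_small)
  then have "\<phi> (\<phi> k) = \<phi> k"
    by (rule add_mod_left_cancel) (simp_all add: lt assms)
  then show ?thesis using phi4[OF assms(2)] by simp
qed

text \<open>The exponents along an orbit are 1111, 3333 or cyclically 2123; the last pattern contains
  an element of exponent 1 that is moved, contradicting \<open>kernel_fixed\<close>.\<close>

lemma e_orbit:
  assumes "a < n"
  shows "e a \<in> {1, 3} \<and> e (\<phi> a) = e a"
proof -
  let ?b = "\<phi> a" let ?c = "\<phi> ?b" let ?d = "\<phi> ?c"
  have l: "?b < n" "?c < n" "?d < n" using assms lt by auto
  have r: "e x = 1 \<or> e x = 2 \<or> e x = 3" if "x < n" for x
    using e_neq_0[OF that] e_less[OF that] by linarith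
  have s: "(e ?d + e a) mod 4 \<noteq> 0"
    using e_adjacent[OF l(3)] phi4[OF assms] by simp
  have f: "\<not> (e x = 2 \<and> e k = 1 \<and> e (\<phi> k) \<noteq> 1)" if "x < n" "k < n" for x k
    using kernel_fixed that by metis
  show ?thesis
    by (rule orbit_pattern[OF r[OF assms] r[OF l(1)] r[OF l(2)] r[OF l(3)]
          e_adjacent[OF assms] e_adjacent[OF l(1)] e_adjacent[OF l(2)] s e_cycle[OF assms]
          f[OF assms l(1)] f[OF assms l(3), unfolded phi4[OF assms]] f[OF l(1) assms] f[OF l(1) l(2)]])
qed

lemma e_pow: "a < n \<Longrightarrow> e ((\<phi> ^^ k) a) = e a"
  by (induction k) (auto simp: e_orbit pow_lt)

text \<open>Associate \<open>a + b + c\<close> in two ways. The exponent on \<open>c\<close> is a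
  sum of \<open>e a\<close> terms along the orbit of \<open>b\<close>, and all of them equal
  \<open>e b\<close> because exponents are constant on orbits.\<close>

lemma e_mult:
  assumes "a < n" "b < n"
  shows "e ((a + b) mod n) = e a * e b mod 4"
proof (rule e_unique)
  fix c assume c: "c < n"
  have "\<phi> (((a + b) mod n + c) mod n) = \<phi> ((a + (b + c) mod n) mod n)"
    by (simp add: mod_simps ac_simps)
  also have "\<dots> = (\<phi> a + (\<phi> ^^ e a) ((b + c) mod n)) mod n"
    using e_add assms n by simp
  also have "\<dots> = (\<phi> a + ((\<phi> ^^ e a) b + (\<phi> ^^ (e a * e b)) c)) mod n"
    using pow_add[OF assms(2) c] assms by (simp add: e_pow mod_simps)
  also have "\<dots> = (\<phi> ((a + b) mod n) + (\<phi> ^^ (e a * e b)) c) mod n"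
    using e_add[OF assms] by (simp add: mod_simps ac_simps)
  finally show "\<phi> (((a + b) mod n + c) mod n) = (\<phi> ((a + b) mod n) + (\<phi> ^^ (e a * e b)) c) mod n" .
qed (use n in simp)

text \<open>Since 1 generates Z_n, multiplicativity spreads exponent 1 to every element, and the
  skew law becomes additivity.\<close>

lemma e_1_imp_automorphism:
  assumes "1 < n" "e 1 = 1"
  shows "is_automorphism_map n \<phi>"
proof -
  have "e x = 1" if "x < n" for x
    using that
  proof (induction x)
    case 0
    show ?case using e_unique[of 0 1] n by (simp add: zero lt)
  next
    case (Suc x)
    then show ?case using e_mult[of x 1] assms by simp
  qed
  then show ?thesis
    unfolding is_automorphism_map_def using e_add by simp
qed

text \<open>Properness leaves only \<open>e 1 = 3\<close>, and the powers of 3 modulo 4 alternate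
  between 1 and 3.\<close>

lemma e_parity:
  assumes "1 < n" "\<not> is_automorphism_map n \<phi>" "x < n"
  shows "e x = (if even x then 1 else 3)"
  using assms(3)
proof (induction x)
  case 0
  show ?case using e_unique[of 0 1] n by (simp add: zero lt)
next
  case (Suc x)
  have "e 1 = 3" using e_orbit[of 1] e_1_imp_automorphism assms by auto
  then show ?case using e_mult[of x 1] Suc assms by simp
qed

section \<open>Normal form of a proper skew morphism of order 4\<close>

text \<open>Even elements have exponent 1, so \<open>\<phi>\<close> is additive from them:
  \<open>\<phi> 2\<close> governs the evens and \<open>\<phi> 1\<close> supplies the offset on the
  odds.\<close>

lemma twist_form:
  assumes n2: "n = 2 * m" and m: "1 < m" and nonaut: "\<not> is_automorphism_map n \<phi>"
    and s: "s = \<phi> 2 div 2" and h: "h = \<phi> 1 div 2"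
  shows "x < n \<Longrightarrow> \<phi> x = twist s h x mod n" "(s, h) \<in> twist_params m"
proof -
  have n1: "1 < n" using m n2 by simp
  note ep = e_parity[OF n1 nonaut]
  \<comment> \<open>Exponents distinguish the parities and are constant on orbits; hence
    \<open>\<phi>\<close> keeps parity and the halvings defining \<open>s\<close> and
    \<open>h\<close> lose nothing.\<close>
  have par: "even (\<phi> x) \<longleftrightarrow> even x" if "x < n" for x
    using e_orbit[OF that] ep[OF that] ep[OF lt[OF that]]
    by (metis numeral_eq_one_iff num.distinct(3))
  have n3: "3 < n" using m n2 by simp
  have p2: "\<phi> 2 = 2 * s" and p1: "\<phi> 1 = Suc (2 * h)"
    using par[of 2] par[of 1] n3 by (simp_all add: s h)
  have ev: "\<phi> (2 * y) = 2 * (s * y) mod n" if "2 * y < n" for y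
    using that
  proof (induction y)
    case 0
    then show ?case by (simp add: zero)
  next
    case (Suc y)
    have "e (2 * y) = 1" using ep[of "2 * y"] Suc n3 by simp
    then have "\<phi> (2 * Suc y) = (\<phi> (2 * y) + \<phi> 2) mod n"
      using e_add[of "2 * y" 2] Suc n3 by simp
    then show ?case using Suc p2 by (simp add: mod_simps algebra_simps)
  qed
  have od: "\<phi> (Suc (2 * y)) = Suc (2 * (s * y + h)) mod n" if "Suc (2 * y) < n" for y
  proof -
    have "e (2 * y) = 1" using ep[of "2 * y"] that n3 by simp
    then have "\<phi> (Suc (2 * y)) = (\<phi> (2 * y) + \<phi> 1) mod n"
      using e_add[of "2 * y" 1] that n3 by simp
    also have "\<dots> = (2 * (s * y) + Suc (2 * h)) mod n"
      using ev[of y] p1 that by (simp only: mod_add_left_eq Suc_lessD)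
    finally show ?thesis by (simp add: algebra_simps)
  qed
  show tw: "\<phi> x = twist s h x mod n" if "x < n" for x
    using that by (cases x rule: nat_cases_parity) (simp_all add: ev od)
  have pw: "(\<phi> ^^ k) x = (twist s h ^^ k) x mod (2 * m)" if "x < n" for k x
    using funpow_eq_twist[of m \<phi> s h x k] tw that n2 m by simp
  have e1: "e 1 = 3" using ep[of 1] n3 by simp
  have "s < m" "h < m"
    using lt[of 2] lt[of 1] p2 p1 n2 n3 by auto
  have tw1: "twist s h 1 = Suc (2 * h)" "twist s h 2 = 2 * s"
    by (simp_all add: twist_def)
  then have tw: "(twist s h ^^ 2) 2 = 2 * (s * s)"
    "(twist s h ^^ 3) 1 = Suc (2 * (s * (s * h + h) + h))"
    "(twist s h ^^ 4) 1 = Suc (2 * (s * (s * (s * h + h) + h) + h))"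
    by (simp_all only: funpow_small twist_even twist_odd)
  \<comment> \<open>Expand \<open>\<phi> 3\<close> as 2 + 1 with exponent 1 and as 1 + 2 with
    exponent 3.\<close>
  have pw3: "(\<phi> ^^ 3) 2 = \<phi> 2"
  proof -
    have "\<phi> 3 = (\<phi> 2 + \<phi> 1) mod n"
      using e_add[of 2 1] ep[of 2] n3 by simp
    moreover have "\<phi> 3 = (\<phi> 1 + (\<phi> ^^ 3) 2) mod n"
      using e_add[of 1 2] e1 n3 by (simp del: One_nat_def)
    ultimately show ?thesis
      using add_mod_left_cancel[of "\<phi> 1" "(\<phi> ^^ 3) 2" n "\<phi> 2"] pow_lt[of 2 3] lt[of 2] n3
      by (simp add: add.commute)
  qed
  have pw2: "(\<phi> ^^ 2) 2 = 2"
    using pw3 phi4[of 2] n3 by (simp add: funpow_small)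
  have ss: "[s * s = 1] (mod m)"
  proof -
    have "[2 * (s * s) = 2 * 1] (mod (2 * m))"
      using pw[of 2 2] unfolding pw2 tw cong_def using n3 n2 by simp
    then show ?thesis by (simp only: cong_double_iff)
  qed
  have s2: "[s * (s * h) = h] (mod m)"
    using cong_mult[OF ss cong_refl[of h]] by (simp add: ac_simps)
  \<comment> \<open>This is \<open>(\<phi> ^^ 4) 1 = 1\<close> read on halves;
    \<open>s * s = 1\<close> then collapses it to the third congruence.\<close>
  have "[s * (s * (s * h + h) + h) + h = 0] (mod m)"
  proof -
    have "[Suc (2 * (s * (s * (s * h + h) + h) + h)) = Suc (2 * 0)] (mod (2 * m))"
      using pw[of 1 4] pow4[of 1] n3 n2 unfolding tw cong_def by simp
    then show ?thesis by (simp only: cong_Suc_double_iff)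
  qed
  moreover have "[s * (s * (s * h + h) + h) + h = 2 * (h + s * h)] (mod m)"
    using cong_add[OF cong_add[OF cong_mult[OF cong_refl[of s] s2] s2] cong_refl[of "s * h + h"]]
    by (simp add: algebra_simps mult_2 mult_2_right)
  ultimately have d2: "[2 * (h + s * h) = 0] (mod m)"
    by (meson cong_sym cong_trans)
  \<comment> \<open>The skew law at 1 + 1, where the exponent of 1 is 3.\<close>
  have "[s = Suc h + (s * (s * h + h) + h)] (mod m)"
  proof -
    have "\<phi> 2 = (\<phi> 1 + (\<phi> ^^ 3) 1) mod n"
      using e_add[of 1 1] e1 n3 by (simp add: numeral_2_eq_2)
    then have "[2 * s = Suc (2 * h) + Suc (2 * (s * (s * h + h) + h))] (mod (2 * m))"
      using pw[of 1 3] p1 p2 n3 n2 lt[of 2] unfolding tw cong_def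
      by (simp only: mod_add_right_eq mod_less)
    also have "Suc (2 * h) + Suc (2 * (s * (s * h + h) + h)) = 2 * (Suc h + (s * (s * h + h) + h))"
      by simp
    finally show ?thesis by (simp only: cong_double_iff)
  qed
  also have "[Suc h + (s * (s * h + h) + h) = 1 + 3 * h + s * h] (mod m)"
    using cong_add[OF s2 cong_refl[of "Suc (2 * h + s * h)"]]
    by (simp add: algebra_simps mult_2 mult_2_right eval_nat_numeral)
  finally have d3: "[s = 1 + 3 * h + s * h] (mod m)" .
  \<comment> \<open>Otherwise the square would be the identity: it multiplies halves by
    \<open>s * s\<close> and shifts those of odd elements by \<open>h + s * h\<close>.\<close>
  have d1: "\<not> m dvd h + s * h"
  proof
    assume *: "m dvd h + s * h"
    have "(\<phi> ^^ 2) x = x" if x: "x < n" for x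
    proof -
      have "[twist s h (twist s h x) = x] (mod (2 * m))"
      proof (cases x rule: nat_cases_parity)
        case (even y)
        have "[s * (s * y) = y] (mod m)"
          using cong_mult[OF ss cong_refl[of y]] by (simp add: ac_simps)
        then show ?thesis
          unfolding even by (simp only: twist_even cong_double_iff)
      next
        case (odd y)
        have "[s * s * y + (h + s * h) = 1 * y + 0] (mod m)"
          using * by (intro cong_add cong_mult ss cong_refl) (simp add: cong_0_iff)
        moreover have "s * (s * y + h) + h = s * s * y + (h + s * h)"
          by (simp add: algebra_simps)
        ultimately show ?thesis
          unfolding odd by (simp only: twist_odd cong_Suc_double_iff mult_1 add_0_right)
      qed
      then show ?thesis
        using pw[OF x, of 2] x n2 by (simp add: funpow_small cong_def)
    qed
    then show False using pow2 by blast
  qed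
  show "(s, h) \<in> twist_params m"
    using \<open>s < m\<close> \<open>h < m\<close> ss d1 d2 d3 by (simp add: twist_params_def twist_sys_def)
qed

end

section \<open>From solutions of the system to skew morphisms\<close>

text \<open>The cube is the power that occurs in the skew law at odd elements;
  \<open>s * s = 1\<close> makes it affine with the same slope \<open>s\<close>.\<close>

lemma twist_funpow_3:
  assumes "twist_sys m s h"
  shows "[(twist s h ^^ 3) (2 * z) = 2 * (s * z)] (mod (2 * m))"
    and "[(twist s h ^^ 3) (Suc (2 * z)) = Suc (2 * (s * z + 2 * h + s * h))] (mod (2 * m))"
proof -
  have ss: "[s * (s * y) = y] (mod m)" for y
    using cong_mult[of "s * s" 1 m y y] assms by (simp add: twist_sys_def ac_simps)
  then show "[(twist s h ^^ 3) (2 * z) = 2 * (s * z)] (mod (2 * m))"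
    by (simp add: funpow_small cong_double_iff)
  have "[s * (s * (s * z)) + s * (s * h) + (s * h + h) = s * z + h + (s * h + h)] (mod m)"
    by (intro cong_add ss cong_refl)
  moreover have "s * (s * (s * z)) + s * (s * h) + (s * h + h) = s * (s * (s * z + h) + h) + h"
    by (simp add: algebra_simps)
  moreover have "s * z + h + (s * h + h) = s * z + 2 * h + s * h"
    by simp
  ultimately show "[(twist s h ^^ 3) (Suc (2 * z)) = Suc (2 * (s * z + 2 * h + s * h))] (mod (2 * m))"
    by (simp only: funpow_small twist_odd cong_Suc_double_iff)
qed

text \<open>Evens return by \<open>s * s = 1\<close>; halves of odds gain
  \<open>2 * (h + s * h)\<close> in four steps, which the third congruence kills.\<close>

lemma twist_funpow_4:
  assumes "twist_sys m s h"
  shows "[(twist s h ^^ 4) x = x] (mod (2 * m))"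
proof -
  have ss: "[s * (s * y) = y] (mod m)" for y
    using cong_mult[of "s * s" 1 m y y] assms by (simp add: twist_sys_def ac_simps)
  have eq: "(twist s h ^^ 4) x = twist s h ((twist s h ^^ 3) x)"
    by (simp add: funpow_small)
  show ?thesis
  proof (cases x rule: nat_cases_parity)
    case (even y)
    have "[twist s h ((twist s h ^^ 3) x) = twist s h (2 * (s * y))] (mod (2 * m))"
      unfolding even by (intro twist_cong twist_funpow_3 assms)
    also have "[twist s h (2 * (s * y)) = 2 * y] (mod (2 * m))"
      using ss by (simp add: cong_double_iff)
    finally show ?thesis unfolding eq by (simp only: even)
  next
    case (odd y)
    have "[twist s h ((twist s h ^^ 3) x) = twist s h (Suc (2 * (s * y + 2 * h + s * h)))] (mod (2 * m))"
      unfolding odd by (intro twist_cong twist_funpow_3 assms)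
    also have "[twist s h (Suc (2 * (s * y + 2 * h + s * h))) = Suc (2 * y)] (mod (2 * m))"
    proof -
      have "s * (s * y + 2 * h + s * h) + h = s * (s * y) + s * (s * h) + (2 * (s * h) + h)"
        by (simp add: algebra_simps)
      also have "[\<dots> = y + h + (2 * (s * h) + h)] (mod m)"
        by (intro cong_add ss cong_refl)
      also have "y + h + (2 * (s * h) + h) = y + 2 * (h + s * h)"
        by simp
      also have "[\<dots> = y + 0] (mod m)"
        using assms by (intro cong_add cong_refl) (simp add: twist_sys_def)
      finally show ?thesis by (simp only: twist_odd cong_Suc_double_iff add_0_right)
    qed
    finally show ?thesis unfolding eq by (simp only: odd)
  qed
qed

text \<open>For even \<open>a\<close> this is an identity of natural numbers. For odd
  \<open>a\<close> and even \<open>b\<close> it needs \<open>s * s = 1\<close>; two odds carry an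
  extra 1 into the half, hence an extra \<open>s\<close>, which the second congruence
  rewrites.\<close>

lemma twist_add:
  assumes "twist_sys m s h"
  shows "[twist s h (a + b) = twist s h a + (twist s h ^^ (if even a then 1 else 3)) b] (mod (2 * m))"
proof (cases a rule: nat_cases_parity)
  case (even y)
  then have "twist s h (a + b) = twist s h a + twist s h b"
    by (cases b rule: nat_cases_parity)
      (simp_all only: add_Suc_right twist_even twist_odd flip: distrib_left,
        simp_all add: algebra_simps)
  then show ?thesis by (simp add: even)
next
  case (odd y)
  have "[twist s h (a + b) = twist s h a + (twist s h ^^ 3) b] (mod (2 * m))"
  proof (cases b rule: nat_cases_parity)
    case b: (even z)
    have "a + b = Suc (2 * (y + z))" by (simp add: odd b)
    then have "twist s h (a + b) = Suc (2 * (s * (y + z) + h))"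
      by (simp only: twist_odd)
    also have "\<dots> = twist s h a + 2 * (s * z)"
      unfolding odd twist_odd by (simp add: algebra_simps)
    also have "[\<dots> = twist s h a + (twist s h ^^ 3) b] (mod (2 * m))"
      unfolding b by (intro cong_add cong_refl cong_sym[OF twist_funpow_3(1)] assms)
    finally show ?thesis .
  next
    case b: (odd z)
    have "a + b = 2 * Suc (y + z)" by (simp add: odd b)
    then have "twist s h (a + b) = 2 * (s * y + s * z + s)"
      by (simp only: twist_even) (simp add: algebra_simps)
    also have "[\<dots> = 2 * (s * y + s * z + (1 + 3 * h + s * h))] (mod (2 * m))"
      unfolding cong_double_iff using assms
      by (intro cong_add cong_refl) (simp add: twist_sys_def)
    also have "2 * (s * y + s * z + (1 + 3 * h + s * h)) =
        twist s h a + Suc (2 * (s * z + 2 * h + s * h))"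
      unfolding odd twist_odd by (simp add: algebra_simps)
    also have "[\<dots> = twist s h a + (twist s h ^^ 3) b] (mod (2 * m))"
      unfolding b by (intro cong_add cong_refl cong_sym[OF twist_funpow_3(2)] assms)
    finally show ?thesis .
  qed
  then show ?thesis by (simp add: odd)
qed

lemma twist_perm_in_proper_skew_of_order:
  assumes m: "1 < m" and sh: "(s, h) \<in> twist_params m"
  shows "twist_perm (2 * m) s h \<in> proper_skew_of_order (2 * m) 4"
proof -
  define n where "n = 2 * m"
  define F where "F = twist_perm n s h"
  have sys: "twist_sys m s h" and nondeg: "\<not> m dvd h + s * h"
    using sh by (auto simp: twist_params_def)
  have n3: "3 < n" using m by (simp add: n_def)
  have F: "F x = twist s h x mod n" if "x < n" for x
    using that by (simp add: F_def twist_perm_def)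
  have pw: "(F ^^ k) x = (twist s h ^^ k) x mod n" if "x < n" for k x
    using funpow_eq_twist[of m F s h x k] F that m by (simp add: n_def)
  have F_lt: "F x < n" if "x < n" for x
    using F[OF that] n3 by simp
  have pow4: "(F ^^ 4) x = x" if "x < n" for x
    using pw[OF that, of 4] twist_funpow_4[OF sys, of x] that by (simp add: cong_def n_def)
  have F4: "F (F (F (F x))) = x" if "x < n" for x
    using pow4[OF that] by (simp only: funpow_small)
  have F0: "F 0 = 0"
    using F[of 0] n3 by (simp add: twist_def)
  \<comment> \<open>The cube is the inverse, as the fourth power is the identity.\<close>
  have bij: "bij_betw F {..<n} {..<n}"
    by (rule bij_betw_byWitness[where f' = "\<lambda>x. F (F (F x))"]) (auto simp: F4 F_lt)
  have law: "F ((a + b) mod n) = (F a + (F ^^ (if even a then 1 else 3)) b) mod n"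
    if "a < n" "b < n" for a b
  proof -
    have "F ((a + b) mod n) = twist s h ((a + b) mod n) mod n"
      using F n3 by simp
    also have "\<dots> = twist s h (a + b) mod n"
      using twist_cong[of "(a + b) mod n" "a + b" m s h] by (simp add: n_def cong_def)
    also have "\<dots> = (twist s h a + (twist s h ^^ (if even a then 1 else 3)) b) mod n"
      using twist_add[OF sys, of a b] by (simp only: n_def cong_def)
    also have "\<dots> = (F a + (F ^^ (if even a then 1 else 3)) b) mod n"
      by (simp only: F[OF that(1)] pw[OF that(2)] mod_add_eq)
    finally show ?thesis .
  qed
  have skew: "skew_morphism n F"
    unfolding skew_morphism_def
  proof (intro conjI allI impI)
    show "F x = x" if "n \<le> x" for x
      using that by (simp add: F_def twist_perm_def)
    show "\<exists>i. \<forall>b<n. F ((a + b) mod n) = (F a + (F ^^ i) b) mod n" if "a < n" for a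
      using law[OF that] by blast
  qed (fact bij F0)+
  have F1: "F 1 = Suc (2 * h) mod n" and F2: "F 2 = 2 * s mod n"
    using F[of 1] F[of 2] n3 by (simp_all add: twist_def)
  \<comment> \<open>Additivity at 1 + 1 would give \<open>s = 1 + 2 * h\<close> modulo
    \<open>m\<close>; the second congruence differs from this by exactly
    \<open>h + s * h\<close>.\<close>
  have nonaut: "\<not> is_automorphism_map n F"
  proof
    assume "is_automorphism_map n F"
    then have "F ((1 + 1) mod n) = (F 1 + F 1) mod n"
      using n3 unfolding is_automorphism_map_def by (meson less_trans numeral_less_iff one_less_numeral_iff semiring_norm(77))
    then have "F 2 = (F 1 + F 1) mod n"
      using n3 by (simp del: One_nat_def)
    then have "[2 * s = 2 * (1 + 2 * h)] (mod (2 * m))"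
      unfolding F1 F2 by (simp add: cong_def n_def mod_add_eq)
    then have "[s = 1 + 2 * h] (mod m)"
      by (simp only: cong_double_iff)
    moreover have "[s = (1 + 2 * h) + (h + s * h)] (mod m)"
      using sys by (simp add: twist_sys_def algebra_simps)
    ultimately have "[(1 + 2 * h) + 0 = (1 + 2 * h) + (h + s * h)] (mod m)"
      by (metis add_0_right cong_sym cong_trans)
    then have "[0 = h + s * h] (mod m)"
      by (simp only: cong_add_lcancel_nat)
    then show False
      using nondeg cong_0_iff cong_sym by blast
  qed
  have sq: "F (F 1) \<noteq> 1"
  proof
    assume "F (F 1) = 1"
    then have "twist s h (twist s h 1) mod n = 1"
      using pw[of 1 2] n3 by (simp add: funpow_small)
    moreover have "twist s h 1 = Suc (2 * h)"
      by (simp add: twist_def)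
    ultimately have "[Suc (2 * (s * h + h)) = Suc (2 * 0)] (mod (2 * m))"
      using n3 by (simp add: cong_def n_def)
    then have "[s * h + h = 0] (mod m)"
      by (simp only: cong_Suc_double_iff)
    then show False
      using nondeg by (simp add: cong_0_iff add.commute)
  qed
  have "skew_order n F = 4"
    unfolding skew_order_def
  proof (rule Least_equality)
    fix k assume k: "0 < k \<and> (\<forall>x<n. (F ^^ k) x = x)"
    then have k1: "(F ^^ k) 1 = 1" using n3 by simp
    show "4 \<le> k"
    proof (rule ccontr)
      assume "\<not> 4 \<le> k"
      then consider "k = 1" | "k = 2" | "k = 3" using k by linarith
      then show False
      proof cases
        case 1
        then show False using k1 sq by simp
      next
        case 2
        then show False using k1 sq by (simp add: funpow_small)
      next
        \<comment> \<open>With the fourth power trivial, a cube fixing 1 forces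
          \<open>F 1 = 1\<close>, so the square would fix 1 too.\<close>
        case 3
        then have "F (F (F 1)) = 1" using k1 by (simp add: funpow_small)
        then show False using F4[of 1] sq n3 by simp
      qed
    qed
  qed (use pow4 in simp)
  then show ?thesis
    using skew nonaut
    by (simp add: proper_skew_of_order_def proper_skew_morphism_def flip: F_def n_def)
qed

text \<open>\<open>skew_order\<close> is a \<open>LEAST\<close> and so junk unless some power is the identity;
  finiteness of \<open>{..<n}\<close> supplies one.\<close>

lemma order4_skew_of_order_4:
  assumes n: "0 < n" and \<phi>: "\<phi> \<in> proper_skew_of_order n 4"
  shows "order4_skew n \<phi>"
proof -
  have sk: "skew_morphism n \<phi>" and so: "skew_order n \<phi> = 4"
    using \<phi> by (auto simp: proper_skew_of_order_def proper_skew_morphism_def)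
  have bij: "bij_betw \<phi> {..<n} {..<n}"
    using sk by (simp add: skew_morphism_def)
  have "\<phi> permutes {..<n}"
    using sk by (intro bij_imp_permutes) (auto simp: skew_morphism_def)
  then have "permutation \<phi>"
    using permutation_permutes by blast
  then obtain k where "\<phi> ^^ k = id" "0 < k"
    using permutation_is_nilpotent by blast
  then have ex: "0 < k \<and> (\<forall>x<n. (\<phi> ^^ k) x = x)" by simp
  have p4: "\<forall>x<n. (\<phi> ^^ 4) x = x"
    using LeastI[where P = "\<lambda>k. 0 < k \<and> (\<forall>x<n. (\<phi> ^^ k) x = x)", OF ex] so
    by (simp add: skew_order_def)
  have "\<not> (\<forall>x<n. (\<phi> ^^ 2) x = x)"
    using not_less_Least[where P = "\<lambda>k. 0 < k \<and> (\<forall>x<n. (\<phi> ^^ k) x = x)" and k = 2] so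
    by (auto simp: skew_order_def)
  then show ?thesis
    using sk bij p4 n by unfold_locales (auto simp: skew_morphism_def bij_betw_def)
qed

section \<open>Bijection between solutions and skew morphisms\<close>

text \<open>Injectivity reads \<open>h\<close> and \<open>s\<close> off the values at 1 and 2, which
  the bounds below \<open>m\<close> keep unreduced; surjectivity is the normal form.\<close>

lemma bij_betw_twist_perm:
  assumes m: "1 < m"
  shows "bij_betw (\<lambda>(s, h). twist_perm (2 * m) s h) (twist_params m) (proper_skew_of_order (2 * m) 4)"
  unfolding bij_betw_def
proof (intro conjI subset_antisym)
  show "inj_on (\<lambda>(s, h). twist_perm (2 * m) s h) (twist_params m)"
  proof (rule inj_onI, clarify)
    fix s h s' h'
    assume sh: "(s, h) \<in> twist_params m" "(s', h') \<in> twist_params m"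
      and eq: "twist_perm (2 * m) s h = twist_perm (2 * m) s' h'"
    have l: "s < m" "h < m" "s' < m" "h' < m"
      using sh by (simp_all add: twist_params_def)
    have "twist_perm (2 * m) s h 1 = Suc (2 * h)" "twist_perm (2 * m) s h 2 = 2 * s"
      "twist_perm (2 * m) s' h' 1 = Suc (2 * h')" "twist_perm (2 * m) s' h' 2 = 2 * s'"
      using l m by (simp_all add: twist_perm_def twist_def)
    then show "s = s' \<and> h = h'"
      unfolding eq by simp
  qed
  show "(\<lambda>(s, h). twist_perm (2 * m) s h) ` twist_params m \<subseteq> proper_skew_of_order (2 * m) 4"
    using twist_perm_in_proper_skew_of_order[OF m] by auto
  show "proper_skew_of_order (2 * m) 4 \<subseteq> (\<lambda>(s, h). twist_perm (2 * m) s h) ` twist_params m"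
  proof
    fix \<phi> assume \<phi>: "\<phi> \<in> proper_skew_of_order (2 * m) 4"
    interpret order4_skew "2 * m" \<phi>
      using order4_skew_of_order_4[OF _ \<phi>] m by simp
    have na: "\<not> is_automorphism_map (2 * m) \<phi>" and out: "2 * m \<le> x \<Longrightarrow> \<phi> x = x" for x
      using \<phi> by (auto simp: proper_skew_of_order_def proper_skew_morphism_def skew_morphism_def)
    obtain s h where sh: "(s, h) \<in> twist_params m"
      and tw: "\<And>x. x < 2 * m \<Longrightarrow> \<phi> x = twist s h x mod (2 * m)"
      using that[OF twist_form(2)[OF refl m na refl refl] twist_form(1)[OF refl m na refl refl]] .
    have "\<phi> = twist_perm (2 * m) s h"
      unfolding twist_perm_def using tw out by (intro ext) simp
    then have "\<phi> = (\<lambda>(s, h). twist_perm (2 * m) s h) (s, h)" by simp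
    then show "\<phi> \<in> (\<lambda>(s, h). twist_perm (2 * m) s h) ` twist_params m"
      using sh by (rule image_eqI)
  qed
qed

section \<open>Counting the solutions prime by prime\<close>

lemma twist_sys_cong:
  assumes "[s = s'] (mod m)" "[h = h'] (mod m)"
  shows "twist_sys m s h \<longleftrightarrow> twist_sys m s' h'" "m dvd h + s * h \<longleftrightarrow> m dvd h' + s' * h'"
proof -
  have c: "[s * s = s' * s'] (mod m)" "[1 + 3 * h + s * h = 1 + 3 * h' + s' * h'] (mod m)"
    "[2 * (h + s * h) = 2 * (h' + s' * h')] (mod m)" "[h + s * h = h' + s' * h'] (mod m)"
    by (intro cong_add cong_mult cong_refl assms)+
  show "twist_sys m s h \<longleftrightarrow> twist_sys m s' h'" "m dvd h + s * h \<longleftrightarrow> m dvd h' + s' * h'"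
    using c assms(1) by (simp_all add: twist_sys_def cong_def dvd_eq_mod_eq_0)
qed

lemma twist_sys_mult:
  assumes "coprime m k"
  shows "twist_sys (m * k) s h \<longleftrightarrow> twist_sys m s h \<and> twist_sys k s h"
proof -
  have "[a = b] (mod (m * k)) \<longleftrightarrow> [a = b] (mod m) \<and> [a = b] (mod k)" for a b
    using assms coprime_cong_mult_nat cong_modulus_mult_nat by (metis mult.commute)
  then show ?thesis unfolding twist_sys_def by blast
qed

text \<open>Cancel 2 in the third congruence. Odd primes thus never contribute to nondegeneracy,
  which is decided by the remaining factor of the modulus.\<close>

lemma twist_sys_prime_imp_dvd:
  assumes "prime p" "odd p" "twist_sys p s h"
  shows "p dvd h + s * h"
proof -
  have "p dvd 2 * (h + s * h)" using assms by (simp add: twist_sys_def cong_0_iff)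
  moreover have "\<not> p dvd 2"
    using assms by (metis primes_dvd_imp_eq two_is_prime_nat)
  ultimately show ?thesis using assms(1) prime_dvd_mult_iff by blast
qed

text \<open>Modulo \<open>p\<close> the product \<open>h * (s + 1)\<close> vanishes. If
  \<open>h = 0\<close>, the second congruence gives \<open>s = 1\<close>; otherwise
  \<open>s = -1\<close>, and it becomes \<open>2 * (h + 1) = 0\<close>, so
  \<open>h = -1\<close>.\<close>

lemma twist_sys_prime:
  assumes p: "prime p" "odd p"
  shows "{(s, h). s < p \<and> h < p \<and> twist_sys p s h} = {(1, 0), (p - 1, p - 1)}"
proof (intro subset_antisym subsetI; clarsimp)
  have p3: "3 \<le> p"
    using p prime_ge_2_nat[of p] by (cases "p = 2") auto
  fix s h assume l: "s < p" "h < p" and sys: "twist_sys p s h" and ne: "s = p - Suc 0 \<longrightarrow> h \<noteq> p - Suc 0"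
  have eq: "[s = 1 + 3 * h + s * h] (mod p)" using sys by (simp add: twist_sys_def)
  have "p dvd h + s * h" by (rule twist_sys_prime_imp_dvd[OF p sys])
  then have d: "p dvd h * Suc s" by (simp add: algebra_simps)
  have "h = 0"
  proof (rule ccontr)
    assume "h \<noteq> 0"
    then have "\<not> p dvd h" using l by (auto dest: dvd_imp_le)
    then have ps: "p dvd Suc s" using d p prime_dvd_mult_iff by blast
    then have s: "s = p - 1" using l by (auto dest: dvd_imp_le)
    \<comment> \<open>Adding 1 to both sides turns \<open>s = -1\<close> into a divisibility free of
      subtraction.\<close>
    have "[s + 1 = 1 + 3 * h + s * h + 1] (mod p)"
      using eq by (intro cong_add cong_refl)
    then have "p dvd 1 + 3 * h + s * h + 1"
      using ps cong_dvd_iff by fastforce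
    moreover have "1 + 3 * h + s * h + 1 = h * Suc s + 2 * Suc h" by simp
    ultimately have "p dvd 2 * Suc h" using d dvd_add_right_iff by metis
    moreover have "\<not> p dvd 2" using p3 by (auto dest: dvd_imp_le)
    ultimately have "p dvd Suc h" using p prime_dvd_mult_iff by blast
    then have "h = p - 1" using l by (auto dest: dvd_imp_le)
    then show False using ne s by simp
  qed
  moreover have "s = Suc 0"
    using eq \<open>h = 0\<close> l p3 by (simp add: cong_def)
  ultimately show "s = Suc 0 \<and> h = 0" by simp
next
  have p3: "3 \<le> p"
    using p prime_ge_2_nat[of p] by (cases "p = 2") auto
  \<comment> \<open>With \<open>p = j + 2\<close>, the solution \<open>(-1, -1)\<close> is
    \<open>(j + 1, j + 1)\<close>, and the congruences become identities up to explicit multiples of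
    \<open>p\<close>.\<close>
  define j where "j = p - 2"
  with p3 have j: "p = Suc (Suc j)" by simp
  fix s h assume "s = Suc 0 \<and> h = 0 \<or> s = p - Suc 0 \<and> h = p - Suc 0"
  then show "s < p \<and> h < p \<and> twist_sys p s h"
  proof (elim disjE conjE)
    assume "s = Suc 0" "h = 0"
    then show ?thesis using p3 by (simp add: twist_sys_def)
  next
    assume "s = p - Suc 0" "h = p - Suc 0"
    then have s: "s = Suc j" "h = Suc j" by (simp_all add: j)
    have "s * s = 1 + p * j" "1 + 3 * h + s * h = s + p * p" "2 * (h + s * h) = p * (2 * Suc j)"
      by (simp_all add: s j algebra_simps)
    then have "twist_sys p s h"
      unfolding twist_sys_def by (simp only: cong_def) (simp only: mod_mult_self2 mod_mult_self1 mod_mult_self1_is_0 mod_0)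
    then show ?thesis by (simp add: s j)
  qed
qed

text \<open>The Chinese remainder theorem in both coordinates: a nondegenerate solution modulo
  \<open>m\<close> is paired with either of the two solutions modulo \<open>p\<close>.\<close>

lemma card_twist_params_mult_prime:
  assumes m: "0 < m" and p: "prime p" "odd p" and cop: "coprime m p"
  shows "card (twist_params (m * p)) = card (twist_params m) * 2"
proof -
  define T where "T = {(s, h). s < p \<and> h < p \<and> twist_sys p s h}"
  have p0: "0 < p" using p prime_gt_0_nat by blast
  have mem: "(s, h) \<in> twist_params (m * p) \<longleftrightarrow>
      s < m * p \<and> h < m * p \<and> twist_sys m s h \<and> twist_sys p s h \<and> \<not> m dvd h + s * h" for s h
    using twist_sys_prime_imp_dvd[OF p, of s h] divides_mult[of m "h + s * h" p] cop
    by (auto simp: twist_params_def twist_sys_mult[OF cop] dest: dvd_mult_left)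
  have c: "[s mod k = s] (mod k)" for s k :: nat by simp
  have "bij_betw (\<lambda>(s, h). ((s mod m, h mod m), (s mod p, h mod p)))
      (twist_params (m * p)) (twist_params m \<times> T)"
    unfolding bij_betw_def
  proof (intro conjI subset_antisym)
    show "inj_on (\<lambda>(s, h). ((s mod m, h mod m), (s mod p, h mod p))) (twist_params (m * p))"
    proof (rule inj_onI, clarsimp simp: mem)
      fix s h s' h'
      assume l: "s < m * p" "h < m * p" "s' < m * p" "h' < m * p"
        and "s mod m = s' mod m" "h mod m = h' mod m" "s mod p = s' mod p" "h mod p = h' mod p"
      then have "[s = s'] (mod (m * p))" "[h = h'] (mod (m * p))"
        using cop by (simp_all add: coprime_cong_mult_nat cong_def[of _ _ m] cong_def[of _ _ p])
      then show "s = s' \<and> h = h'" using l by (simp add: cong_def)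
    qed
    show "(\<lambda>(s, h). ((s mod m, h mod m), (s mod p, h mod p))) ` twist_params (m * p) \<subseteq> twist_params m \<times> T"
      using twist_sys_cong[OF c c] m p0 by (auto simp: mem twist_params_def[of m] T_def)
    show "twist_params m \<times> T \<subseteq> (\<lambda>(s, h). ((s mod m, h mod m), (s mod p, h mod p))) ` twist_params (m * p)"
    proof clarify
      fix a b c d assume ab: "(a, b) \<in> twist_params m" and cd: "(c, d) \<in> T"
      obtain s where s: "s < m * p" "[s = a] (mod m)" "[s = c] (mod p)"
        using binary_chinese_remainder_unique_nat[OF cop, of a c] m p0 by auto
      obtain h where h: "h < m * p" "[h = b] (mod m)" "[h = d] (mod p)"
        using binary_chinese_remainder_unique_nat[OF cop, of b d] m p0 by auto
      have "(s, h) \<in> twist_params (m * p)"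
        unfolding mem using ab cd s(1) h(1) twist_sys_cong[OF s(2) h(2)] twist_sys_cong[OF s(3) h(3)]
        by (simp add: twist_params_def T_def)
      moreover have "s mod m = a" "h mod m = b" "s mod p = c" "h mod p = d"
        using ab cd s h by (auto simp: twist_params_def T_def cong_def)
      ultimately show "((a, b), (c, d)) \<in> (\<lambda>(s, h). ((s mod m, h mod m), (s mod p, h mod p))) ` twist_params (m * p)"
        by (force intro: image_eqI)
    qed
  qed
  then have "card (twist_params (m * p)) = card (twist_params m) * card T"
    by (simp add: bij_betw_same_card card_cartesian_product)
  moreover have "card T = 2"
    using p unfolding T_def twist_sys_prime[OF p] by (auto simp: card_insert_if)
  ultimately show ?thesis by simp
qed

text \<open>The first congruence makes \<open>s\<close> odd. Then \<open>s = 5\<close> contradicts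
  the second one and \<open>s = 7\<close> is degenerate, while \<open>s = 1\<close> and
  \<open>s = 3\<close> admit two values of \<open>h\<close> each.\<close>

lemma card_twist_params_8: "card (twist_params 8) = 4"
proof -
  have cases8: "x = 0 \<or> x = 1 \<or> x = 2 \<or> x = 3 \<or> x = 4 \<or> x = 5 \<or> x = 6 \<or> x = 7"
    if "x < 8" for x :: nat
    using that by presburger
  have "twist_params 8 = {(1, 2), (1, 6), (3, 3), (3, 7)}"
  proof (intro subset_antisym subrelI)
    fix s h assume "(s, h) \<in> twist_params 8"
    then have "s < 8" "h < 8" and sys: "s * s mod 8 = 1" "s mod 8 = (1 + 3 * h + s * h) mod 8"
        "2 * (h + s * h) mod 8 = 0" "(h + s * h) mod 8 \<noteq> 0"
      by (simp_all add: twist_params_def twist_sys_def cong_def dvd_eq_mod_eq_0)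
    from sys(1) cases8[OF \<open>s < 8\<close>] have "s = 1 \<or> s = 3 \<or> s = 5 \<or> s = 7"
      by (elim disjE) simp_all
    then show "(s, h) \<in> {(1, 2), (1, 6), (3, 3), (3, 7)}"
      using cases8[OF \<open>h < 8\<close>] sys(2-) by (elim disjE) simp_all
  qed (auto simp: twist_params_def twist_sys_def cong_def)
  then show ?thesis by simp
qed

lemma card_twist_params:
  assumes "finite P" "\<forall>p\<in>P. prime p \<and> odd p"
  shows "card (twist_params (8 * \<Prod>P)) = 2 ^ (card P + 2)"
  using assms
proof (induction P)
  case empty
  then show ?case by (simp add: card_twist_params_8)
next
  case (insert p P)
  have "coprime 2 p" using insert.prems by simp
  then have "coprime (2 ^ 3) p" by (rule coprime_power_left_iff[THEN iffD2, OF disjI1])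
  moreover have "coprime (\<Prod>P) p"
    using insert by (intro prod_coprime_left) (metis insertCI primes_coprime)
  ultimately have cop: "coprime (8 * \<Prod>P) p" by simp
  have "0 < 8 * \<Prod>P"
    using insert by (auto intro!: prod_pos simp: prime_gt_0_nat)
  then have "card (twist_params (8 * \<Prod>P * p)) = card (twist_params (8 * \<Prod>P)) * 2"
    using insert.prems cop by (intro card_twist_params_mult_prime) auto
  then show ?case
    using insert by (simp add: ac_simps)
qed

section \<open>The count for 16 times distinct odd primes, and unboundedness\<close>

lemma card_proper_skew_of_order_4:
  assumes "finite P" "\<forall>p\<in>P. prime p \<and> odd p"
  shows "card (proper_skew_of_order (16 * \<Prod>P) 4) = 2 ^ (card P + 2)"
proof -
  have "0 < \<Prod>P"
    using assms by (auto intro!: prod_pos simp: prime_gt_0_nat)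
  then have "card (twist_params (8 * \<Prod>P)) = card (proper_skew_of_order (2 * (8 * \<Prod>P)) 4)"
    by (intro bij_betw_same_card[OF bij_betw_twist_perm]) simp
  then show ?thesis using card_twist_params[OF assms] by simp
qed

theorem theorem6p7:
  fixes P :: "nat set" and n :: nat
  assumes "finite P"
    and "\<forall>p\<in>P. prime p \<and> odd p"
    and "n = 16 * \<Prod>P"
  shows "card (proper_skew_of_order n 4) = 2 ^ (card P + 2) \<and> \<not> skew_bounded 4"
proof
  show "card (proper_skew_of_order n 4) = 2 ^ (card P + 2)"
    using card_proper_skew_of_order_4 assms by simp
  show "\<not> skew_bounded 4"
  proof
    assume "skew_bounded 4"
    then obtain C where C: "\<And>n. 0 < n \<Longrightarrow> card (proper_skew_of_order n 4) \<le> C"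
      unfolding skew_bounded_def by blast
    \<comment> \<open>Against a bound \<open>C\<close>, any \<open>C\<close> odd primes suffice,
      since \<open>2 ^ (C + 2)\<close> exceeds \<open>C\<close>.\<close>
    have "infinite ({p::nat. prime p} - {2})"
      using primes_infinite by simp
    from infinite_arbitrarily_large[OF this, of C]
    obtain Q where Q: "finite Q" "card Q = C" "Q \<subseteq> {p::nat. prime p} - {2}"
      by blast
    have odd: "\<forall>p\<in>Q. prime p \<and> odd p"
    proof
      fix p assume "p \<in> Q"
      then have "prime p" "p \<noteq> 2" using Q(3) by auto
      then show "prime p \<and> odd p" using primes_dvd_imp_eq[OF two_is_prime_nat] by blast
    qed
    have "0 < \<Prod>Q"
      by (rule prod_pos) (simp add: odd prime_gt_0_nat)
    then have "0 < 16 * \<Prod>Q" by simp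
    from C[OF this] have "2 ^ (C + 2) \<le> C"
      using card_proper_skew_of_order_4[OF Q(1) odd] Q(2) by simp
    moreover have "C + 2 < 2 ^ (C + 2)" by (rule less_exp)
    ultimately show False by linarith
  qed
qed

end
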